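(* Let $\bar y\in[0,1]^{I}$, $\bar v\in\mathbb{R}_{\ge0}^{I}$, and for $\epsilon>0$ let $\bar y^\epsilon_i=\bar y_i$ if $\bar y_i>0$ and $\bar y^\epsilon_i=\epsilon$ if $\bar y_i=0$, and $\bar v^\epsilon_i=\bar v_i$ if $\bar v_i>0$ and $\bar v^\epsilon_i=\epsilon$ if $\bar v_i=0$. Suppose $\epsilon>0$ is such that an optimal dual solution $(\bar\alpha^\epsilon,\bar\beta^\epsilon,\bar\gamma^\epsilon)$ (together with its remaining multipliers) of the perturbed problem $P(\bar y^\epsilon,\bar v^\epsilon)$ is also an optimal solution of the dual of the non-perturbed problem $P(\bar y,\bar v)$. Let $\bar r^\epsilon_{y}$, $\bar r^\epsilon_{v}$ be the reduced costs of the variables $y$ and $v$ in $P(\bar y^\epsilon,\bar v^\epsilon)$ at this dual solution. Then: (1) $\displaystyle \phi'(\bar y,\bar v)=\phi'(\bar y^\epsilon,\bar v^\epsilon)-\epsilon\sum_{i\in I:\,\bar y_i=0}\bar r^\epsilon_{y_i}-\epsilon\sum_{i\in I:\,\bar v_i=0}\bar r^\epsilon_{v_i}$; and (2) the inequality $$\phi'(\bar y,\bar v)+\sum_{i\in I}\bar r^\epsilon_{y_i}(y_i-\bar y_i)+\sum_{i\in I}\bar r^\epsilon_{v_i}(v_i-\bar v_i)\ge D$$ is a valid Benders cut for the non-perturbed problem, i.e. it is satisfied by every $(y,v)\in[0,1]^I\times\mathbb{R}_{\ge0}^I$ with $\phi'(y,v)\ge D$.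
   Context: Data: finite sets $I$ (facilities), $J$ (customers); $I(j)\subseteq I$ for $j\in J$, and $J(i)=\{j\in J: i\in I(j)\}$; $d_j\ge0$, $\hat d_j\ge0$ for $j\in J$; an integer $0\le\Gamma\le|J|$; $0<D\le\sum_{j\in J}d_j$. For $(\bar y,\bar v)\in\mathbb{R}_{\ge 0}^I\times\mathbb{R}_{\ge0}^I$, the (Benders) subproblem $P(\bar y,\bar v)$ is the linear program, with optimal value denoted $\phi'(\bar y,\bar v)$, of maximizing $$\sum_{j\in J}\sum_{i\in I}d_jx_{ij}-\Gamma\tau-\sum_{j\in J}\pi_j$$ over free $y,v\in\mathbb{R}^I$ and nonnegative $x\in\mathbb{R}^{I\times J},\rho\in\mathbb{R}^I,\tau\in\mathbb{R},\pi\in\mathbb{R}^J,\sigma\in\mathbb{R}^{I\times J}$ subject to (dual multipliers in brackets) - $\sum_{j\in J}d_jx_{ij}+\Gamma\rho_i+\sum_{j\in J}\sigma_{ij}-v_i\le0$ for $i\in I$ $[\lambda_i\ge0]$; - $\tau+\pi_j-\sum_{i\in I}\hat d_jx_{ij}\ge0$ for $j\in J$ $[\mu_j\ge 0$ after multiplying the constraint by $-1]$; - $\sigma_{ij}+\rho_i-\hat d_jx_{ij}\ge0$ for $j\in J,i\in I(j)$ $[\nu_{ij}\ge 0$ after multiplying the constraint by $-1]$; - $\sum_{i\in I}x_{ij}\le1$ for $j\in J$ $[\alpha_j\ge0]$; - $x_{ij}-y_i\le0$ for $j\in J,i\in I(j)$ $[\eta_{ij}\ge0]$; - $y_i=\bar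 y_i$ for $i\in I$ $[\beta_i$ free$]$; - $v_i=\bar v_i$ for $i\in I$ $[\gamma_i$ free$]$. The dual of $P(\bar y,\bar v)$ is its LP dual: minimize $\sum_{j}\alpha_j+\sum_i\bar y_i\beta_i+\sum_i\bar v_i\gamma_i$ over these multipliers subject to the usual dual constraints. An optimal dual solution is named by its components $(\alpha,\beta,\gamma)$, the other components $\lambda,\mu,\nu,\eta$ being understood. Reduced costs: the fixing constraints $y_i=\bar y_i$, $v_i=\bar v_i$ are regarded as variable bounds. The reduced cost of a variable $y_i$ (resp. $v_i$) at a given dual solution is its objective coefficient (here $0$) minus the inner product of its column in the remaining constraints with the multipliers of those constraints; explicitly, $r_{y_i}=\sum_{j\in J(i)}\eta_{ij}$ and $r_{v_i}=\lambda_i$. *)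

theory Defs
  imports Complex_Main
begin

record ('i, 'j) flp =
  facilities :: "'i set"
  customers :: "'j set"
  eligible :: "'j \<Rightarrow> 'i set"   \<comment> \<open>\<open>I(j)\<close>\<close>
  demand :: "'j \<Rightarrow> real"      \<comment> \<open>\<open>d\<close>\<close>
  deviation :: "'j \<Rightarrow> real"   \<comment> \<open>\<open>d\<close>-hat\<close>
  budget :: nat               \<comment> \<open>\<open>\<Gamma>\<close>\<close>

definition covered :: "('i, 'j) flp \<Rightarrow> 'i \<Rightarrow> 'j set" where  \<comment> \<open>\<open>J(i)\<close>\<close>
  "covered P i = {j \<in> customers P. i \<in> eligible P j}"

definition flp_data :: "('i, 'j) flp \<Rightarrow> bool" where
  "flp_data P \<longleftrightarrow>
     finite (facilities P) \<and> finite (customers P) \<and>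
     (\<forall>j\<in>customers P. eligible P j \<subseteq> facilities P) \<and>
     (\<forall>j\<in>customers P. 0 \<le> demand P j) \<and>
     (\<forall>j\<in>customers P. 0 \<le> deviation P j) \<and>
     budget P \<le> card (customers P)"

text \<open>Vectors indexed by facilities or customers are total functions; only their values on
  \<open>facilities P\<close> and \<open>customers P\<close> are ever used.\<close>

record ('i, 'j) primal =
  p_y :: "'i \<Rightarrow> real"
  p_v :: "'i \<Rightarrow> real"
  p_x :: "'i \<Rightarrow> 'j \<Rightarrow> real"
  p_rho :: "'i \<Rightarrow> real"
  p_tau :: real
  p_pi :: "'j \<Rightarrow> real"
  p_sigma :: "'i \<Rightarrow> 'j \<Rightarrow> real"

definition primal_feasible ::
  "('i, 'j) flp \<Rightarrow> ('i \<Rightarrow> real) \<Rightarrow> ('i \<Rightarrow> real) \<Rightarrow> ('i, 'j) primal \<Rightarrow> bool" where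
  "primal_feasible P ybar vbar s \<longleftrightarrow>
     (\<forall>i\<in>facilities P. \<forall>j\<in>customers P. 0 \<le> p_x s i j) \<and>
     (\<forall>i\<in>facilities P. 0 \<le> p_rho s i) \<and>
     0 \<le> p_tau s \<and>
     (\<forall>j\<in>customers P. 0 \<le> p_pi s j) \<and>
     (\<forall>i\<in>facilities P. \<forall>j\<in>customers P. 0 \<le> p_sigma s i j) \<and>
     (\<forall>i\<in>facilities P.
        (\<Sum>j\<in>customers P. demand P j * p_x s i j) + real (budget P) * p_rho s i
          + (\<Sum>j\<in>customers P. p_sigma s i j) - p_v s i \<le> 0) \<and>
     (\<forall>j\<in>customers P.
        p_tau s + p_pi s j - (\<Sum>i\<in>facilities P. deviation P j * p_x s i j) \<ge> 0) \<and>
     (\<forall>j\<in>customers P. \<forall>i\<in>eligible P j.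
        p_sigma s i j + p_rho s i - deviation P j * p_x s i j \<ge> 0) \<and>
     (\<forall>j\<in>customers P. (\<Sum>i\<in>facilities P. p_x s i j) \<le> 1) \<and>
     (\<forall>j\<in>customers P. \<forall>i\<in>eligible P j. p_x s i j - p_y s i \<le> 0) \<and>
     (\<forall>i\<in>facilities P. p_y s i = ybar i) \<and>
     (\<forall>i\<in>facilities P. p_v s i = vbar i)"

definition primal_obj :: "('i, 'j) flp \<Rightarrow> ('i, 'j) primal \<Rightarrow> real" where
  "primal_obj P s =
     (\<Sum>j\<in>customers P. \<Sum>i\<in>facilities P. demand P j * p_x s i j)
       - real (budget P) * p_tau s - (\<Sum>j\<in>customers P. p_pi s j)"

text \<open>The optimal value \<open>\<phi>'\<close>. For nonnegative \<open>ybar\<close>, \<open>vbar\<close> the supremum is that of a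
  nonempty set that is bounded above (see the two lemmas that follow), hence never a junk value.\<close>

definition opt_value :: "('i, 'j) flp \<Rightarrow> ('i \<Rightarrow> real) \<Rightarrow> ('i \<Rightarrow> real) \<Rightarrow> real" where
  "opt_value P ybar vbar = Sup (primal_obj P ` {s. primal_feasible P ybar vbar s})"

lemma primal_feasible_exists:
  assumes "flp_data P"
    and "\<And>i. i \<in> facilities P \<Longrightarrow> 0 \<le> ybar i" and "\<And>i. i \<in> facilities P \<Longrightarrow> 0 \<le> vbar i"
  shows "primal_feasible P ybar vbar
    \<lparr>p_y = ybar, p_v = vbar, p_x = (\<lambda>_ _. 0), p_rho = (\<lambda>_. 0), p_tau = 0, p_pi = (\<lambda>_. 0),
     p_sigma = (\<lambda>_ _. 0)\<rparr>"
  using assms by (auto simp: primal_feasible_def flp_data_def)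

lemma primal_obj_bounded:
  assumes P: "flp_data P" and s: "primal_feasible P ybar vbar s"
  shows "primal_obj P s \<le> (\<Sum>j\<in>customers P. demand P j)"
proof -
  have "(\<Sum>j\<in>customers P. \<Sum>i\<in>facilities P. demand P j * p_x s i j)
      = (\<Sum>j\<in>customers P. demand P j * (\<Sum>i\<in>facilities P. p_x s i j))"
    by (simp add: sum_distrib_left)
  also have "\<dots> \<le> (\<Sum>j\<in>customers P. demand P j * 1)"
    using P s by (intro sum_mono mult_left_mono) (auto simp: flp_data_def primal_feasible_def)
  finally have "(\<Sum>j\<in>customers P. \<Sum>i\<in>facilities P. demand P j * p_x s i j)
      \<le> (\<Sum>j\<in>customers P. demand P j)" by simp
  moreover have "0 \<le> real (budget P) * p_tau s" "0 \<le> (\<Sum>j\<in>customers P. p_pi s j)"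
    using s by (auto simp: primal_feasible_def intro: sum_nonneg)
  ultimately show ?thesis by (simp add: primal_obj_def)
qed

record ('i, 'j) dual =
  d_lambda :: "'i \<Rightarrow> real"
  d_mu :: "'j \<Rightarrow> real"
  d_nu :: "'i \<Rightarrow> 'j \<Rightarrow> real"
  d_alpha :: "'j \<Rightarrow> real"
  d_eta :: "'i \<Rightarrow> 'j \<Rightarrow> real"
  d_beta :: "'i \<Rightarrow> real"
  d_gamma :: "'i \<Rightarrow> real"

text \<open>The last seven conjuncts are the dual constraints of the primal columns
  \<open>y\<^sub>i\<close>, \<open>v\<^sub>i\<close> (free, hence equations), \<open>x\<^sub>i\<^sub>j\<close>, \<open>\<rho>\<^sub>i\<close>, \<open>\<tau>\<close>, \<open>\<pi>\<^sub>j\<close>, \<open>\<sigma>\<^sub>i\<^sub>j\<close>, in this order.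
  The multipliers \<open>\<nu>\<^sub>i\<^sub>j\<close>, \<open>\<eta>\<^sub>i\<^sub>j\<close> exist only for \<open>i \<in> I(j)\<close>, whence the case distinctions.\<close>

definition dual_feasible :: "('i, 'j) flp \<Rightarrow> ('i, 'j) dual \<Rightarrow> bool" where
  "dual_feasible P z \<longleftrightarrow>
     (\<forall>i\<in>facilities P. 0 \<le> d_lambda z i) \<and>
     (\<forall>j\<in>customers P. 0 \<le> d_mu z j) \<and>
     (\<forall>j\<in>customers P. \<forall>i\<in>eligible P j. 0 \<le> d_nu z i j) \<and>
     (\<forall>j\<in>customers P. 0 \<le> d_alpha z j) \<and>
     (\<forall>j\<in>customers P. \<forall>i\<in>eligible P j. 0 \<le> d_eta z i j) \<and>
     (\<forall>i\<in>facilities P. d_beta z i - (\<Sum>j\<in>covered P i. d_eta z i j) = 0) \<and>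
     (\<forall>i\<in>facilities P. d_gamma z i - d_lambda z i = 0) \<and>
     (\<forall>i\<in>facilities P. \<forall>j\<in>customers P.
        demand P j * d_lambda z i + deviation P j * d_mu z j + d_alpha z j
          + (if i \<in> eligible P j then deviation P j * d_nu z i j + d_eta z i j else 0)
        \<ge> demand P j) \<and>
     (\<forall>i\<in>facilities P.
        real (budget P) * d_lambda z i - (\<Sum>j\<in>covered P i. d_nu z i j) \<ge> 0) \<and>
     - (\<Sum>j\<in>customers P. d_mu z j) \<ge> - real (budget P) \<and>
     (\<forall>j\<in>customers P. - d_mu z j \<ge> - 1) \<and>
     (\<forall>i\<in>facilities P. \<forall>j\<in>customers P.
        d_lambda z i - (if i \<in> eligible P j then d_nu z i j else 0) \<ge> 0)"

definition dual_obj ::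
  "('i, 'j) flp \<Rightarrow> ('i \<Rightarrow> real) \<Rightarrow> ('i \<Rightarrow> real) \<Rightarrow> ('i, 'j) dual \<Rightarrow> real" where
  "dual_obj P ybar vbar z =
     (\<Sum>j\<in>customers P. d_alpha z j) + (\<Sum>i\<in>facilities P. ybar i * d_beta z i)
       + (\<Sum>i\<in>facilities P. vbar i * d_gamma z i)"

definition dual_optimal ::
  "('i, 'j) flp \<Rightarrow> ('i \<Rightarrow> real) \<Rightarrow> ('i \<Rightarrow> real) \<Rightarrow> ('i, 'j) dual \<Rightarrow> bool" where
  "dual_optimal P ybar vbar z \<longleftrightarrow>
     dual_feasible P z \<and>
     (\<forall>z'. dual_feasible P z' \<longrightarrow> dual_obj P ybar vbar z \<le> dual_obj P ybar vbar z')"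

text \<open>Reduced costs of \<open>y\<^sub>i\<close> and \<open>v\<^sub>i\<close>: objective coefficient \<open>0\<close> minus the inner product of the
  multipliers with the column in the constraints other than \<open>y\<^sub>i = ybar\<^sub>i\<close>, \<open>v\<^sub>i = vbar\<^sub>i\<close>;
  all nonzero entries of these columns are \<open>-1\<close>.\<close>

definition red_cost_y :: "('i, 'j) flp \<Rightarrow> ('i, 'j) dual \<Rightarrow> 'i \<Rightarrow> real" where
  "red_cost_y P z i = (\<Sum>j\<in>covered P i. d_eta z i j)"

definition red_cost_v :: "('i, 'j) dual \<Rightarrow> 'i \<Rightarrow> real" where
  "red_cost_v z i = d_lambda z i"

definition perturb :: "real \<Rightarrow> ('i \<Rightarrow> real) \<Rightarrow> 'i \<Rightarrow> real" where
  "perturb \<epsilon> u i = (if u i = 0 then \<epsilon> else u i)"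

end

theory Submission
  imports Defs
begin

text \<open>
  The dual constraints do not involve \<open>(ybar, vbar)\<close>; only the dual objective does, and on a
  dual feasible \<open>z\<close> the equations for \<open>y\<close> and \<open>v\<close> force \<open>\<beta>\<close> and \<open>\<gamma>\<close> to be the reduced costs. So one
  fixed \<open>z\<close> gives the function
  \<open>L(y, v) = (\<Sum>j. \<alpha> j) + (\<Sum>i. y i * r\<^sub>y i) + (\<Sum>i. v i * r\<^sub>v i)\<close>,
  affine in \<open>(y, v)\<close> with the reduced costs as slopes (\<open>reduced_obj\<close> below). By weak duality
  \<open>L\<close> bounds the optimal value \<open>\<phi>'\<close> from above on the whole nonnegative orthant, and by strong duality
  \<open>L = \<phi>'\<close> wherever \<open>z\<close> is dual optimal. Both claims follow: \<open>z\<close> is optimal at the original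
  and at the perturbed point, and the difference of \<open>L\<close> between the two is \<open>\<epsilon>\<close> times the slopes of
  the perturbed coordinates; and the left side of the cut is exactly \<open>L(y, v)\<close>, an upper bound
  of \<open>\<phi>'(y, v) \<ge> D\<close>.

  The substance is strong duality, in the form that a dual optimum is matched by a feasible
  primal point (\<open>strong_duality_attained\<close>). The inequality saying that \<open>z\<close> is optimal is made
  homogeneous by a scaling variable \<open>t\<close>, and Farkas' lemma writes it as a nonnegative combination of
  the homogenized dual constraints. The multipliers of that combination are the primal point.
\<close>

section \<open>Farkas' lemma\<close>

text \<open>
  Bartl's induction on the number of functionals. If the functional \<open>f a\<close> cannot be dropped, there
  is \<open>x0\<close> violating the reduced implication; then \<open>f a x0 < 0\<close>, and projecting along \<open>x0\<close> onto the
  kernel of \<open>f a\<close> leaves an implication between the remaining functionals.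

  Linearity is expressed through a single operation \<open>axpy x c y\<close>, to be read as \<open>x + c y\<close>. Having
  it as a parameter lets the lemma apply to records of vectors, which are no instance of a vector
  space class.
\<close>

lemma farkas:
  fixes f :: "'r \<Rightarrow> 'v \<Rightarrow> real" and g :: "'v \<Rightarrow> real"
    and axpy :: "'v \<Rightarrow> real \<Rightarrow> 'v \<Rightarrow> 'v"
  assumes "finite R"
    and "\<And>r x c y. r \<in> R \<Longrightarrow> f r (axpy x c y) = f r x + c * f r y"
    and "\<And>x c y. g (axpy x c y) = g x + c * g y"
    and "\<And>x. (\<And>r. r \<in> R \<Longrightarrow> 0 \<le> f r x) \<Longrightarrow> 0 \<le> g x"
  shows "\<exists>u. (\<forall>r\<in>R. 0 \<le> u r) \<and> (\<forall>x. g x = (\<Sum>r\<in>R. u r * f r x))"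
  using assms
proof (induction R arbitrary: f g rule: finite_induct)
  case empty
  have "g x = 0" for x
  proof -
    have "0 \<le> g x" "0 \<le> g (axpy x (-2) x)" using empty(3) by auto
    with empty(2)[of x "-2" x] show ?thesis by linarith
  qed
  then show ?case by simp
next
  case (insert a R)
  note f_lin = insert.prems(1) and g_lin = insert.prems(2) and impl = insert.prems(3)
  show ?case
  proof (cases "\<forall>x. (\<forall>r\<in>R. 0 \<le> f r x) \<longrightarrow> 0 \<le> g x")
    case True
    then obtain u where u: "\<forall>r\<in>R. 0 \<le> u r" "\<forall>x. g x = (\<Sum>r\<in>R. u r * f r x)"
      using insert.IH[of f g] f_lin g_lin by blast
    have "(\<Sum>r\<in>R. (u(a := 0)) r * f r x) = (\<Sum>r\<in>R. u r * f r x)" for x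
      using insert.hyps by (intro sum.cong) auto
    then show ?thesis
      using u insert.hyps by (intro exI[of _ "u(a := 0)"]) auto
  next
    case False
    then obtain x0 where x0: "\<And>r. r \<in> R \<Longrightarrow> 0 \<le> f r x0" "g x0 < 0"
      by (auto simp: not_le)
    have a0: "f a x0 < 0"
      using impl[of x0] x0 by force
    define h where "h x = f a x / f a x0" for x
    define proj where "proj x = axpy x (- h x) x0" for x
    define f' where "f' r x = f r x - h x * f r x0" for r x
    define g' where "g' x = g x - h x * g x0" for x
    have h_lin: "h (axpy x c y) = h x + c * h y" for x c y
      using f_lin[of a x c y] by (simp add: h_def add_divide_distrib)
    have "\<exists>u. (\<forall>r\<in>R. 0 \<le> u r) \<and> (\<forall>x. g' x = (\<Sum>r\<in>R. u r * f' r x))"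
    proof (rule insert.IH)
      show "f' r (axpy x c y) = f' r x + c * f' r y" if "r \<in> R" for r x c y
        using f_lin[of r x c y] that by (simp add: f'_def h_lin algebra_simps)
      show "g' (axpy x c y) = g' x + c * g' y" for x c y
        by (simp add: g'_def h_lin g_lin algebra_simps)
      show "0 \<le> g' x" if nonneg: "\<And>r. r \<in> R \<Longrightarrow> 0 \<le> f' r x" for x
      proof -
        have "0 \<le> g (proj x)"
        proof (rule impl)
          fix r assume r: "r \<in> insert a R"
          have "f r (proj x) = f' r x"
            using f_lin[OF r] by (simp add: proj_def f'_def)
          moreover have "f' a x = 0"
            using a0 by (simp add: f'_def h_def)
          ultimately show "0 \<le> f r (proj x)"
            using r nonneg by auto
        qed
        then show ?thesis by (simp add: proj_def g_lin g'_def)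
      qed
    qed
    then obtain u where u: "\<And>r. r \<in> R \<Longrightarrow> 0 \<le> u r"
      and g': "\<And>x. g' x = (\<Sum>r\<in>R. u r * f' r x)" by blast
    define c where "c = (g x0 - (\<Sum>r\<in>R. u r * f r x0)) / f a x0"
    have "0 \<le> (\<Sum>r\<in>R. u r * f r x0)"
      using u x0 by (intro sum_nonneg) auto
    then have "0 \<le> c"
      using a0 x0(2) by (simp add: c_def divide_nonpos_neg)
    moreover have "g x = c * f a x + (\<Sum>r\<in>R. u r * f r x)" for x
    proof -
      have "g x = h x * g x0 + (\<Sum>r\<in>R. u r * f' r x)"
        using g'[of x] by (simp add: g'_def)
      also have "(\<Sum>r\<in>R. u r * f' r x) = (\<Sum>r\<in>R. u r * f r x) - h x * (\<Sum>r\<in>R. u r * f r x0)"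
        by (simp add: f'_def sum_subtractf sum_distrib_left algebra_simps)
      finally show ?thesis by (simp add: c_def h_def algebra_simps diff_divide_distrib)
    qed
    moreover have "(\<Sum>r\<in>R. (u(a := c)) r * f r x) = (\<Sum>r\<in>R. u r * f r x)" for x
      using insert.hyps by (intro sum.cong) auto
    ultimately show ?thesis
      using u insert.hyps by (intro exI[of _ "u(a := c)"]) auto
  qed
qed

section \<open>The homogenized dual constraints\<close>

datatype ('i, 'j) dual_row =
  Lambda_Row 'i | Mu_Row 'j | Nu_Row 'i 'j | Alpha_Row 'j | Eta_Row 'i 'j
  | X_Row 'i 'j | Rho_Row 'i | Tau_Row | Pi_Row 'j | Sigma_Row 'i 'j | Scale_Row

text \<open>
  Left side minus right side of each dual inequality, with every constant term multiplied by the
  scaling variable \<open>t\<close>; the row \<open>t \<ge> 0\<close> is added. The dual equations only determine \<open>\<beta>\<close> and \<open>\<gamma>\<close>,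
  which are eliminated through them.
\<close>

fun row_slack :: "('i, 'j) flp \<Rightarrow> ('i, 'j) dual_row \<Rightarrow> ('i, 'j) dual \<times> real \<Rightarrow> real" where
  "row_slack P (Lambda_Row i) (z, t) = d_lambda z i"
| "row_slack P (Mu_Row j) (z, t) = d_mu z j"
| "row_slack P (Nu_Row i j) (z, t) = d_nu z i j"
| "row_slack P (Alpha_Row j) (z, t) = d_alpha z j"
| "row_slack P (Eta_Row i j) (z, t) = d_eta z i j"
| "row_slack P (X_Row i j) (z, t) =
     demand P j * d_lambda z i + deviation P j * d_mu z j + d_alpha z j
       + (if i \<in> eligible P j then deviation P j * d_nu z i j + d_eta z i j else 0)
       - demand P j * t"
| "row_slack P (Rho_Row i) (z, t) =
     real (budget P) * d_lambda z i - (\<Sum>j\<in>covered P i. d_nu z i j)"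
| "row_slack P Tau_Row (z, t) = real (budget P) * t - (\<Sum>j\<in>customers P. d_mu z j)"
| "row_slack P (Pi_Row j) (z, t) = t - d_mu z j"
| "row_slack P (Sigma_Row i j) (z, t) =
     d_lambda z i - (if i \<in> eligible P j then d_nu z i j else 0)"
| "row_slack P Scale_Row (z, t) = t"

definition dual_rows :: "('i, 'j) flp \<Rightarrow> ('i, 'j) dual_row set" where
  "dual_rows P =
     Lambda_Row ` facilities P \<union> (Mu_Row ` customers P \<union>
     ((\<lambda>(j, i). Nu_Row i j) ` (SIGMA j:customers P. eligible P j) \<union>
     (Alpha_Row ` customers P \<union>
     ((\<lambda>(j, i). Eta_Row i j) ` (SIGMA j:customers P. eligible P j) \<union>
     ((\<lambda>(i, j). X_Row i j) ` (facilities P \<times> customers P) \<union>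
     (Rho_Row ` facilities P \<union> ({Tau_Row} \<union> (Pi_Row ` customers P \<union>
     ((\<lambda>(i, j). Sigma_Row i j) ` (facilities P \<times> customers P) \<union> {Scale_Row})))))))))"

lemma finite_eligible: "flp_data P \<Longrightarrow> j \<in> customers P \<Longrightarrow> finite (eligible P j)"
  by (auto simp: flp_data_def intro: finite_subset)

lemma finite_covered: "flp_data P \<Longrightarrow> finite (covered P i)"
  by (auto simp: flp_data_def covered_def)

lemma finite_dual_rows: "flp_data P \<Longrightarrow> finite (dual_rows P)"
  using finite_eligible[of P] by (auto simp: dual_rows_def flp_data_def)

lemma sum_dual_rows:
  fixes h :: "('i, 'j) dual_row \<Rightarrow> real"
  assumes P: "flp_data P"
  shows "sum h (dual_rows P) =
    (\<Sum>i\<in>facilities P. h (Lambda_Row i)) + (\<Sum>j\<in>customers P. h (Mu_Row j))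
    + (\<Sum>j\<in>customers P. \<Sum>i\<in>eligible P j. h (Nu_Row i j))
    + (\<Sum>j\<in>customers P. h (Alpha_Row j))
    + (\<Sum>j\<in>customers P. \<Sum>i\<in>eligible P j. h (Eta_Row i j))
    + (\<Sum>i\<in>facilities P. \<Sum>j\<in>customers P. h (X_Row i j))
    + (\<Sum>i\<in>facilities P. h (Rho_Row i)) + h Tau_Row + (\<Sum>j\<in>customers P. h (Pi_Row j))
    + (\<Sum>i\<in>facilities P. \<Sum>j\<in>customers P. h (Sigma_Row i j)) + h Scale_Row"
proof -
  have fin: "finite (facilities P)" "finite (customers P)"
    "finite (SIGMA j:customers P. eligible P j)" "\<forall>j\<in>customers P. finite (eligible P j)"
    using P finite_eligible[OF P] by (auto simp: flp_data_def)
  have split: "sum h (A \<union> B) = sum h A + sum h B"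
    if "finite A" "finite B" "A \<inter> B = {}" for A B
    using that by (rule sum.union_disjoint)
  show ?thesis
    unfolding dual_rows_def
    apply (subst split, use fin in force, use fin in force, force)+
    apply (subst sum.reindex, force simp: inj_on_def)+
    apply (simp add: o_def case_prod_unfold sum.Sigma fin)
    done
qed


section \<open>The dual objective as an affine function of the right-hand side\<close>

definition dual_axpy ::
  "('i, 'j) dual \<times> real \<Rightarrow> real \<Rightarrow> ('i, 'j) dual \<times> real \<Rightarrow> ('i, 'j) dual \<times> real" where
  "dual_axpy p c q =
    (\<lparr>d_lambda = \<lambda>i. d_lambda (fst p) i + c * d_lambda (fst q) i,
      d_mu = \<lambda>j. d_mu (fst p) j + c * d_mu (fst q) j,
      d_nu = \<lambda>i j. d_nu (fst p) i j + c * d_nu (fst q) i j,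
      d_alpha = \<lambda>j. d_alpha (fst p) j + c * d_alpha (fst q) j,
      d_eta = \<lambda>i j. d_eta (fst p) i j + c * d_eta (fst q) i j,
      d_beta = \<lambda>i. d_beta (fst p) i + c * d_beta (fst q) i,
      d_gamma = \<lambda>i. d_gamma (fst p) i + c * d_gamma (fst q) i\<rparr>,
     snd p + c * snd q)"

lemma row_slack_axpy: "row_slack P r (dual_axpy p c q) = row_slack P r p + c * row_slack P r q"
  by (cases p; cases q; cases r)
    (auto simp: dual_axpy_def sum.distrib sum_distrib_left algebra_simps)

definition reduced_obj ::
  "('i, 'j) flp \<Rightarrow> ('i \<Rightarrow> real) \<Rightarrow> ('i \<Rightarrow> real) \<Rightarrow> ('i, 'j) dual \<Rightarrow> real" where
  "reduced_obj P y v z =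
     (\<Sum>j\<in>customers P. d_alpha z j) + (\<Sum>i\<in>facilities P. y i * red_cost_y P z i)
       + (\<Sum>i\<in>facilities P. v i * red_cost_v z i)"

lemma dual_obj_eq_reduced_obj:
  assumes "dual_feasible P z"
  shows "dual_obj P y v z = reduced_obj P y v z"
proof -
  have "\<forall>i\<in>facilities P. d_beta z i = red_cost_y P z i \<and> d_gamma z i = red_cost_v z i"
    using assms unfolding dual_feasible_def red_cost_y_def red_cost_v_def by simp
  then show ?thesis by (simp add: dual_obj_def reduced_obj_def)
qed

text \<open>Restores the eliminated multipliers \<open>\<beta>\<close> and \<open>\<gamma>\<close> from their equations.\<close>

definition with_bound_multipliers :: "('i, 'j) flp \<Rightarrow> ('i, 'j) dual \<Rightarrow> ('i, 'j) dual" where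
  "with_bound_multipliers P z = z\<lparr>d_beta := red_cost_y P z, d_gamma := red_cost_v z\<rparr>"

lemma reduced_obj_with_bound_multipliers:
  "reduced_obj P y v (with_bound_multipliers P z) = reduced_obj P y v z"
  by (simp add: with_bound_multipliers_def reduced_obj_def red_cost_y_def red_cost_v_def)

lemma reduced_obj_axpy:
  "reduced_obj P y v (fst (dual_axpy p c q)) =
     reduced_obj P y v (fst p) + c * reduced_obj P y v (fst q)"
  by (simp add: dual_axpy_def reduced_obj_def red_cost_y_def red_cost_v_def
      sum.distrib sum_distrib_left algebra_simps)

lemma dual_feasible_with_bound_multipliers:
  assumes "\<And>r. r \<in> dual_rows P \<Longrightarrow> 0 \<le> row_slack P r (z, 1)"
  shows "dual_feasible P (with_bound_multipliers P z)"
proof -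
  have "0 \<le> row_slack P (Lambda_Row i) (z, 1)" "0 \<le> row_slack P (Rho_Row i) (z, 1)"
    if "i \<in> facilities P" for i
    using that by (auto intro!: assms simp del: row_slack.simps simp: dual_rows_def)
  moreover have "0 \<le> row_slack P (Mu_Row j) (z, 1)" "0 \<le> row_slack P (Alpha_Row j) (z, 1)"
    "0 \<le> row_slack P (Pi_Row j) (z, 1)" if "j \<in> customers P" for j
    using that by (auto intro!: assms simp del: row_slack.simps simp: dual_rows_def)
  moreover have "0 \<le> row_slack P (Nu_Row i j) (z, 1)" "0 \<le> row_slack P (Eta_Row i j) (z, 1)"
    if "j \<in> customers P" "i \<in> eligible P j" for i j
    using that by (force intro!: assms simp del: row_slack.simps simp: dual_rows_def image_iff)+
  moreover have "0 \<le> row_slack P (X_Row i j) (z, 1)" "0 \<le> row_slack P (Sigma_Row i j) (z, 1)"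
    if "i \<in> facilities P" "j \<in> customers P" for i j
    using that by (force intro!: assms simp del: row_slack.simps simp: dual_rows_def image_iff)+
  moreover have "0 \<le> row_slack P Tau_Row (z, 1)"
    by (auto intro!: assms simp del: row_slack.simps simp: dual_rows_def)
  ultimately show ?thesis
    unfolding dual_feasible_def with_bound_multipliers_def red_cost_y_def red_cost_v_def
    by (simp split del: if_split cong: if_cong)
qed

lemma row_slack_scale: "row_slack P r (dual_axpy p c p) = (1 + c) * row_slack P r p"
  by (simp add: row_slack_axpy algebra_simps)

lemma dual_feasible_row_slack:
  assumes "dual_feasible P z" "r \<in> dual_rows P"
  shows "0 \<le> row_slack P r (z, 1)"
  using assms unfolding dual_feasible_def dual_rows_def by auto

section \<open>Strong duality\<close>

text \<open>
  The premise of Farkas' lemma. For \<open>t > 0\<close>, dividing by \<open>t\<close> gives a dual feasible point, to which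
  optimality applies. For \<open>t = 0\<close>, the point is a recession direction of the dual polyhedron, and
  optimality applies to \<open>z\<close> moved one step along it.
\<close>

lemma homogenized_dual_bound:
  assumes opt: "dual_optimal P y v z"
    and rows: "\<And>r. r \<in> dual_rows P \<Longrightarrow> 0 \<le> row_slack P r p"
  shows "snd p * reduced_obj P y v z \<le> reduced_obj P y v (fst p)"
proof -
  have feas: "dual_feasible P z" using opt by (simp add: dual_optimal_def)
  have le: "reduced_obj P y v z \<le> reduced_obj P y v (fst q)"
    if "snd q = 1" and q: "\<And>r. r \<in> dual_rows P \<Longrightarrow> 0 \<le> row_slack P r q" for q
  proof -
    have "q = (fst q, 1)" using that(1) by (simp add: prod_eq_iff)
    then have feas': "dual_feasible P (with_bound_multipliers P (fst q))"
      using q by (metis dual_feasible_with_bound_multipliers)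
    then have "dual_obj P y v z \<le> dual_obj P y v (with_bound_multipliers P (fst q))"
      using opt unfolding dual_optimal_def by blast
    then show ?thesis
      using feas feas'
      by (simp add: dual_obj_eq_reduced_obj reduced_obj_with_bound_multipliers)
  qed
  define t where "t = snd p"
  have "Scale_Row \<in> dual_rows P" by (simp add: dual_rows_def)
  from rows[OF this] have "0 \<le> t" by (cases p) (simp add: t_def)
  then consider "t = 0" | "0 < t" by linarith
  then show ?thesis
  proof cases
    case 1
    let ?q = "dual_axpy (z, 1) 1 p"
    have "reduced_obj P y v z \<le> reduced_obj P y v (fst ?q)"
    proof (rule le)
      show "snd ?q = 1" using 1 by (simp add: dual_axpy_def t_def)
      show "0 \<le> row_slack P r ?q" if "r \<in> dual_rows P" for r
        using that feas rows by (simp add: row_slack_axpy dual_feasible_row_slack)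
    qed
    then show ?thesis using 1 by (simp add: reduced_obj_axpy t_def)
  next
    case 2
    \<comment> \<open>Scaling by \<open>1 / t\<close>, expressed as \<open>p + (1 / t - 1) p\<close>.\<close>
    let ?q = "dual_axpy p (1 / t - 1) p"
    have "reduced_obj P y v z \<le> reduced_obj P y v (fst ?q)"
    proof (rule le)
      show "snd ?q = 1" using 2 by (simp add: dual_axpy_def t_def[symmetric] field_simps)
      show "0 \<le> row_slack P r ?q" if "r \<in> dual_rows P" for r
        using that 2 rows by (simp add: row_slack_scale)
    qed
    also have "reduced_obj P y v (fst ?q) = reduced_obj P y v (fst p) / t"
      by (simp add: reduced_obj_axpy algebra_simps)
    finally show ?thesis using 2 by (simp add: t_def[symmetric] field_simps)
  qed
qed

definition zero_dual :: "('i, 'j) dual" where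
  "zero_dual = \<lparr>d_lambda = \<lambda>_. 0, d_mu = \<lambda>_. 0, d_nu = \<lambda>_ _. 0, d_alpha = \<lambda>_. 0,
     d_eta = \<lambda>_ _. 0, d_beta = \<lambda>_. 0, d_gamma = \<lambda>_. 0\<rparr>"

lemma sum_if_const: "(\<Sum>x\<in>A. if c then f x else 0) = (if c then sum f A else (0::real))"
  by simp

text \<open>
  Farkas' lemma expresses \<open>reduced_obj P y v z' - t * reduced_obj P y v z\<close>, as a function of
  \<open>(z', t)\<close>, as a nonnegative combination of the row slacks at \<open>(z', t)\<close>.
  The multiplier of the row of a primal column is the value of that primal variable.
\<close>

lemma strong_duality_attained:
  fixes P :: "('i, 'j) flp" and z :: "('i, 'j) dual"
  assumes P: "flp_data P" and opt: "dual_optimal P y v z"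
  shows "\<exists>s. primal_feasible P y v s \<and> dual_obj P y v z \<le> primal_obj P s"
proof -
  let ?w = "reduced_obj P y v z"
  define g where "g p = reduced_obj P y v (fst p) - snd p * ?w" for p :: "('i, 'j) dual \<times> real"
  have "\<exists>u. (\<forall>r\<in>dual_rows P. 0 \<le> u r)
      \<and> (\<forall>p. g p = (\<Sum>r\<in>dual_rows P. u r * row_slack P r p))"
  proof (rule farkas[where axpy = dual_axpy])
    show "finite (dual_rows P)" using P by (rule finite_dual_rows)
    show "g (dual_axpy p c q) = g p + c * g q" for p c q
    proof -
      have "snd (dual_axpy p c q) = snd p + c * snd q" by (simp add: dual_axpy_def)
      then show ?thesis by (simp add: g_def reduced_obj_axpy algebra_simps)
    qed
    show "0 \<le> g p" if "\<And>r. r \<in> dual_rows P \<Longrightarrow> 0 \<le> row_slack P r p" for p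
      using homogenized_dual_bound[OF opt that] by (simp add: g_def)
  qed (rule row_slack_axpy)
  then obtain u where u: "\<And>r. r \<in> dual_rows P \<Longrightarrow> 0 \<le> u r"
    and "\<And>p. g p = (\<Sum>r\<in>dual_rows P. u r * row_slack P r p)" by blast
  note combination = this(2)[unfolded sum_dual_rows[OF P] g_def]
  have fin: "finite (facilities P)" "finite (customers P)"
    "\<And>i. finite (covered P i)" "\<And>j. j \<in> customers P \<Longrightarrow> finite (eligible P j)"
    using P finite_covered[OF P] finite_eligible[OF P] by (auto simp: flp_data_def)
  have elig: "\<And>i j. j \<in> customers P \<Longrightarrow> i \<in> eligible P j \<Longrightarrow> i \<in> facilities P"
    using P by (auto simp: flp_data_def)

  note ev = reduced_obj_def red_cost_y_def red_cost_v_def zero_dual_def fin distrib_left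
    sum.distrib sum_distrib_left right_diff_distrib sum_subtractf sum_if_const
    if_distrib[where f = uminus] if_distrib[where f = "\<lambda>x. _ * x"]
  \<comment> \<open>Two linear functionals agree iff they agree on the unit vectors. The unit vector of a dual
    variable yields the primal constraint paired with it, the multiplier of its sign constraint
    being the slack.\<close>

  let ?unit = "\<lambda>k x. if x = k then 1 else 0 :: real"
  let ?unit2 = "\<lambda>i j i' j'. if j' = j then if i' = i then 1 else 0 else 0 :: real"
  have lambda: "v i = u (Lambda_Row i) + (\<Sum>j\<in>customers P. u (X_Row i j) * demand P j)
      + u (Rho_Row i) * real (budget P) + (\<Sum>j\<in>customers P. u (Sigma_Row i j))"
    if "i \<in> facilities P" for i
    using combination[of "(zero_dual\<lparr>d_lambda := ?unit i\<rparr>, 0)"] that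
    by (simp add: ev cong: if_cong)
  have mu: "u Tau_Row + u (Pi_Row j)
      = u (Mu_Row j) + (\<Sum>i\<in>facilities P. deviation P j * u (X_Row i j))"
    if "j \<in> customers P" for j
    using combination[of "(zero_dual\<lparr>d_mu := ?unit j\<rparr>, 0)"] that
    by (simp add: ev mult.commute cong: if_cong)
  have alpha: "1 = u (Alpha_Row j) + (\<Sum>i\<in>facilities P. u (X_Row i j))"
    if "j \<in> customers P" for j
    using combination[of "(zero_dual\<lparr>d_alpha := ?unit j\<rparr>, 0)"] that
    by (simp add: ev cong: if_cong)
  \<comment> \<open>The scaling variable compares the objective values instead: the primal one exceeds \<open>?w\<close> by the
    multiplier of \<open>t \<ge> 0\<close>.\<close>
  have scale: "?w + real (budget P) * u Tau_Row + (\<Sum>j\<in>customers P. u (Pi_Row j))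
      + u Scale_Row = (\<Sum>i\<in>facilities P. \<Sum>j\<in>customers P. demand P j * u (X_Row i j))"
    using combination[of "(zero_dual, 1)"]
    by (simp add: ev sum_negf mult.commute cong: if_cong)
  \<comment> \<open>For the doubly indexed variables these two rules bring the index test of the unit vector
    to the front, where \<open>sum.delta\<close> applies.\<close>
  have elig_swap:
    "(if i' \<in> eligible P j' then if j' = j then a else 0 else 0)
     = (if j' = j then if i' \<in> eligible P j then a else 0 else 0)" for i' j j' and a :: real
    by auto
  have covered_iff: "j \<in> covered P i \<longleftrightarrow> j \<in> customers P \<and> i \<in> eligible P j" for i j
    by (auto simp: covered_def)
  have nu: "u (Sigma_Row i j) + u (Rho_Row i) = u (Nu_Row i j) + deviation P j * u (X_Row i j)"
    and eta: "y i = u (Eta_Row i j) + u (X_Row i j)"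
    if ij: "j \<in> customers P" "i \<in> eligible P j" for i j
  proof -
    have elig_absorb: "(if i' \<in> eligible P j then if i' = i then a else 0 else 0)
        = (if i' = i then a else 0)" for i' and a :: real
      using ij by auto
    show "y i = u (Eta_Row i j) + u (X_Row i j)"
      using combination[of "(zero_dual\<lparr>d_eta := ?unit2 i j\<rparr>, 0)"] ij elig[OF ij]
      by (simp add: ev elig_swap elig_absorb covered_iff cong: if_cong)
    show "u (Sigma_Row i j) + u (Rho_Row i) = u (Nu_Row i j) + deviation P j * u (X_Row i j)"
      using combination[of "(zero_dual\<lparr>d_nu := ?unit2 i j\<rparr>, 0)"] ij elig[OF ij]
      by (simp add: ev elig_swap elig_absorb covered_iff mult.commute cong: if_cong)
  qed
  have u_nonneg:
    "i \<in> facilities P \<Longrightarrow> 0 \<le> u (Lambda_Row i)"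
    "i \<in> facilities P \<Longrightarrow> 0 \<le> u (Rho_Row i)"
    "j \<in> customers P \<Longrightarrow> 0 \<le> u (Mu_Row j)"
    "j \<in> customers P \<Longrightarrow> 0 \<le> u (Alpha_Row j)"
    "j \<in> customers P \<Longrightarrow> 0 \<le> u (Pi_Row j)"
    "j \<in> customers P \<Longrightarrow> i \<in> eligible P j \<Longrightarrow> 0 \<le> u (Nu_Row i j)"
    "j \<in> customers P \<Longrightarrow> i \<in> eligible P j \<Longrightarrow> 0 \<le> u (Eta_Row i j)"
    "i \<in> facilities P \<Longrightarrow> j \<in> customers P \<Longrightarrow> 0 \<le> u (X_Row i j)"
    "i \<in> facilities P \<Longrightarrow> j \<in> customers P \<Longrightarrow> 0 \<le> u (Sigma_Row i j)"
    "0 \<le> u Tau_Row" "0 \<le> u Scale_Row" for i j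
    by (rule u, force simp: dual_rows_def)+
  define s where "s = \<lparr>p_y = y, p_v = v, p_x = \<lambda>i j. u (X_Row i j), p_rho = \<lambda>i. u (Rho_Row i),
    p_tau = u Tau_Row, p_pi = \<lambda>j. u (Pi_Row j), p_sigma = \<lambda>i j. u (Sigma_Row i j)\<rparr>"
  have "(\<Sum>i\<in>facilities P. u (X_Row i j)) \<le> 1" if "j \<in> customers P" for j
    using alpha[OF that] u_nonneg(4)[OF that] by linarith
  moreover have "(\<Sum>i\<in>facilities P. deviation P j * u (X_Row i j)) \<le> u Tau_Row + u (Pi_Row j)"
    if "j \<in> customers P" for j
    using mu[OF that] u_nonneg(3)[OF that] by linarith
  moreover have "deviation P j * u (X_Row i j) \<le> u (Sigma_Row i j) + u (Rho_Row i)"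
    "u (X_Row i j) \<le> y i" if "j \<in> customers P" "i \<in> eligible P j" for i j
    using nu[OF that] eta[OF that] u_nonneg(6,7)[OF that] by linarith+
  moreover have "(\<Sum>j\<in>customers P. demand P j * u (X_Row i j)) + real (budget P) * u (Rho_Row i)
      + (\<Sum>j\<in>customers P. u (Sigma_Row i j)) \<le> v i" if "i \<in> facilities P" for i
    using lambda[OF that] u_nonneg(1)[OF that] by (simp add: mult.commute)
  ultimately have "primal_feasible P y v s"
    using u_nonneg by (simp add: primal_feasible_def s_def)
  moreover have "primal_obj P s = ?w + u Scale_Row"
    using scale sum.swap[of "\<lambda>i j. demand P j * u (X_Row i j)" "customers P" "facilities P"]
    by (simp add: primal_obj_def s_def)
  moreover have "dual_obj P y v z = ?w"
    using opt by (simp add: dual_optimal_def dual_obj_eq_reduced_obj)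
  ultimately show ?thesis
    using u_nonneg(11) by (intro exI[of _ s]) simp
qed

section \<open>Weak duality and the optimal value\<close>

lemma sum_eligible_eq_sum_covered:
  fixes h :: "'i \<Rightarrow> 'j \<Rightarrow> real"
  assumes P: "flp_data P"
  shows "(\<Sum>j\<in>customers P. \<Sum>i\<in>eligible P j. h i j)
    = (\<Sum>i\<in>facilities P. \<Sum>j\<in>covered P i. h i j)"
proof -
  have "(\<Sum>j\<in>customers P. \<Sum>i\<in>eligible P j. h i j)
      = (\<Sum>j\<in>customers P. \<Sum>i | i \<in> facilities P \<and> i \<in> eligible P j. h i j)"
    using P by (intro sum.cong) (auto simp: flp_data_def)
  also have "\<dots> = (\<Sum>i\<in>facilities P. \<Sum>j | j \<in> customers P \<and> i \<in> eligible P j. h i j)"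
    using P by (intro sum.swap_restrict) (auto simp: flp_data_def)
  finally show ?thesis by (simp add: covered_def)
qed

text \<open>
  The usual estimate: the dual constraint of each column, weighted by the primal variable, bounds the
  objective; exchanging the order of summation turns this into the primal constraints weighted by
  the multipliers.
\<close>

lemma weak_duality:
  fixes P :: "('i, 'j) flp"
  assumes P: "flp_data P" and s: "primal_feasible P y v s" and z: "dual_feasible P z"
  shows "primal_obj P s \<le> dual_obj P y v z"
proof -
  let ?I = "facilities P" and ?J = "customers P" and ?E = "eligible P" and ?\<Gamma> = "real (budget P)"
  let ?d = "demand P" and ?dh = "deviation P"
  note pf = s[unfolded primal_feasible_def] and df = z[unfolded dual_feasible_def]
  have elig: "i \<in> ?I" if "j \<in> ?J" "i \<in> ?E j" for i j
    using P that by (auto simp: flp_data_def)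
  have restrict: "(\<Sum>i\<in>?I. if i \<in> ?E j then h i else 0) = (\<Sum>i\<in>?E j. h i)"
    if "j \<in> ?J" for j and h :: "'i \<Rightarrow> real"
    using P that by (simp add: flp_data_def sum.inter_restrict[symmetric] Int_absorb1)
  have "(\<Sum>j\<in>?J. \<Sum>i\<in>?I. ?d j * p_x s i j)
      \<le> (\<Sum>j\<in>?J. \<Sum>i\<in>?I. (?d j * d_lambda z i + ?dh j * d_mu z j + d_alpha z j
          + (if i \<in> ?E j then ?dh j * d_nu z i j + d_eta z i j else 0)) * p_x s i j)"
    using pf df by (intro sum_mono mult_right_mono) auto
  also have "\<dots> = (\<Sum>j\<in>?J. \<Sum>i\<in>?I. d_lambda z i * (?d j * p_x s i j))
      + (\<Sum>j\<in>?J. d_mu z j * (\<Sum>i\<in>?I. ?dh j * p_x s i j))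
      + (\<Sum>j\<in>?J. d_alpha z j * (\<Sum>i\<in>?I. p_x s i j))
      + (\<Sum>j\<in>?J. \<Sum>i\<in>?I. if i \<in> ?E j
            then d_nu z i j * (?dh j * p_x s i j) + d_eta z i j * p_x s i j else 0)"
    by (simp add: sum.distrib[symmetric] sum_distrib_left algebra_simps if_distrib[of "\<lambda>x. x * _"]
        cong: if_cong) (intro sum.cong refl, auto simp: algebra_simps)
  also have "(\<Sum>j\<in>?J. \<Sum>i\<in>?I. d_lambda z i * (?d j * p_x s i j))
      = (\<Sum>i\<in>?I. d_lambda z i * (\<Sum>j\<in>?J. ?d j * p_x s i j))"
    by (subst sum.swap) (simp add: sum_distrib_left)
  also have "(\<Sum>j\<in>?J. \<Sum>i\<in>?I. if i \<in> ?E j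
        then d_nu z i j * (?dh j * p_x s i j) + d_eta z i j * p_x s i j else 0)
      = (\<Sum>j\<in>?J. \<Sum>i\<in>?E j. d_nu z i j * (?dh j * p_x s i j) + d_eta z i j * p_x s i j)"
    by (simp add: restrict)
  also have "(\<Sum>i\<in>?I. d_lambda z i * (\<Sum>j\<in>?J. ?d j * p_x s i j))
      \<le> (\<Sum>i\<in>?I. d_lambda z i * (v i - ?\<Gamma> * p_rho s i - (\<Sum>j\<in>?J. p_sigma s i j)))"
    using pf df by (intro sum_mono mult_left_mono) (auto simp: algebra_simps)
  also have "(\<Sum>j\<in>?J. d_mu z j * (\<Sum>i\<in>?I. ?dh j * p_x s i j))
      \<le> (\<Sum>j\<in>?J. d_mu z j * (p_tau s + p_pi s j))"
    using pf df by (intro sum_mono mult_left_mono) auto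
  also have "(\<Sum>j\<in>?J. d_alpha z j * (\<Sum>i\<in>?I. p_x s i j)) \<le> (\<Sum>j\<in>?J. d_alpha z j * 1)"
    using pf df by (intro sum_mono mult_left_mono) auto
  also have "(\<Sum>j\<in>?J. \<Sum>i\<in>?E j. d_nu z i j * (?dh j * p_x s i j) + d_eta z i j * p_x s i j)
      \<le> (\<Sum>j\<in>?J. \<Sum>i\<in>?E j. d_nu z i j * (p_sigma s i j + p_rho s i) + d_eta z i j * y i)"
    using pf df elig by (intro sum_mono add_mono mult_left_mono) auto
  finally have "(\<Sum>j\<in>?J. \<Sum>i\<in>?I. ?d j * p_x s i j)
      \<le> (\<Sum>i\<in>?I. d_lambda z i * (v i - ?\<Gamma> * p_rho s i - (\<Sum>j\<in>?J. p_sigma s i j)))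
        + (\<Sum>j\<in>?J. d_mu z j * (p_tau s + p_pi s j)) + (\<Sum>j\<in>?J. d_alpha z j)
        + (\<Sum>j\<in>?J. \<Sum>i\<in>?E j. d_nu z i j * (p_sigma s i j + p_rho s i) + d_eta z i j * y i)"
    by simp
  also have "(\<Sum>j\<in>?J. \<Sum>i\<in>?E j. d_nu z i j * (p_sigma s i j + p_rho s i) + d_eta z i j * y i)
      = (\<Sum>j\<in>?J. \<Sum>i\<in>?E j. d_nu z i j * p_sigma s i j)
        + (\<Sum>i\<in>?I. (\<Sum>j\<in>covered P i. d_nu z i j) * p_rho s i)
        + (\<Sum>i\<in>?I. y i * red_cost_y P z i)"
    using P by (simp add: distrib_left sum.distrib sum_eligible_eq_sum_covered red_cost_y_def
        sum_distrib_left sum_distrib_right mult.commute)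
  also have "(\<Sum>j\<in>?J. \<Sum>i\<in>?E j. d_nu z i j * p_sigma s i j)
      = (\<Sum>j\<in>?J. \<Sum>i\<in>?I. (if i \<in> ?E j then d_nu z i j else 0) * p_sigma s i j)"
    by (simp add: restrict if_distrib[of "\<lambda>x. x * _"] cong: if_cong)
  also have "\<dots> \<le> (\<Sum>j\<in>?J. \<Sum>i\<in>?I. d_lambda z i * p_sigma s i j)"
    using pf df by (intro sum_mono mult_right_mono) (auto split del: if_split)
  also have "\<dots> = (\<Sum>i\<in>?I. d_lambda z i * (\<Sum>j\<in>?J. p_sigma s i j))"
    by (subst sum.swap) (simp add: sum_distrib_left)
  also have "(\<Sum>i\<in>?I. (\<Sum>j\<in>covered P i. d_nu z i j) * p_rho s i)
      \<le> (\<Sum>i\<in>?I. (?\<Gamma> * d_lambda z i) * p_rho s i)"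
    using pf df by (intro sum_mono mult_right_mono) auto
  also have "(\<Sum>j\<in>?J. d_mu z j * (p_tau s + p_pi s j))
      = (\<Sum>j\<in>?J. d_mu z j) * p_tau s + (\<Sum>j\<in>?J. d_mu z j * p_pi s j)"
    by (simp add: distrib_left sum.distrib sum_distrib_right)
  also have "(\<Sum>j\<in>?J. d_mu z j) * p_tau s \<le> ?\<Gamma> * p_tau s"
    using pf df by (intro mult_right_mono) auto
  also have "(\<Sum>j\<in>?J. d_mu z j * p_pi s j) \<le> (\<Sum>j\<in>?J. 1 * p_pi s j)"
    using pf df by (intro sum_mono mult_right_mono) auto
  finally have "primal_obj P s \<le> reduced_obj P y v z"
    by (simp add: primal_obj_def reduced_obj_def red_cost_v_def right_diff_distrib sum_subtractf
        sum.distrib sum_distrib_left algebra_simps)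
  then show ?thesis using z by (simp add: dual_obj_eq_reduced_obj)
qed

lemma opt_value_le_dual_obj:
  assumes P: "flp_data P"
    and "\<And>i. i \<in> facilities P \<Longrightarrow> 0 \<le> y i" and "\<And>i. i \<in> facilities P \<Longrightarrow> 0 \<le> v i"
    and z: "dual_feasible P z"
  shows "opt_value P y v \<le> dual_obj P y v z"
  unfolding opt_value_def
proof (rule cSup_least)
  show "primal_obj P ` {s. primal_feasible P y v s} \<noteq> {}"
    using primal_feasible_exists[of P y v] assms(1-3) by blast
qed (use weak_duality[OF P _ z] in auto)

lemma strong_duality:
  assumes P: "flp_data P"
    and "\<And>i. i \<in> facilities P \<Longrightarrow> 0 \<le> y i" and "\<And>i. i \<in> facilities P \<Longrightarrow> 0 \<le> v i"
    and opt: "dual_optimal P y v z"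
  shows "opt_value P y v = dual_obj P y v z"
proof (rule antisym)
  show "opt_value P y v \<le> dual_obj P y v z"
    using assms by (intro opt_value_le_dual_obj) (auto simp: dual_optimal_def)
  obtain s where s: "primal_feasible P y v s" "dual_obj P y v z \<le> primal_obj P s"
    using strong_duality_attained[OF P opt] by blast
  have "bdd_above (primal_obj P ` {s. primal_feasible P y v s})"
    using primal_obj_bounded[OF P] by (auto intro!: bdd_aboveI2)
  then have "primal_obj P s \<le> opt_value P y v"
    unfolding opt_value_def using s(1) by (intro cSup_upper) auto
  with s(2) show "dual_obj P y v z \<le> opt_value P y v" by linarith
qed

section \<open>Reduced costs and Benders cuts\<close>

lemma sum_perturb:
  assumes "finite I"
  shows "(\<Sum>i\<in>I. perturb \<epsilon> u i * r i) = (\<Sum>i\<in>I. u i * r i) + \<epsilon> * (\<Sum>i\<in>{i \<in> I. u i = 0}. r i)"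
proof -
  have "(\<Sum>i\<in>I. perturb \<epsilon> u i * r i) = (\<Sum>i\<in>I. u i * r i + (if u i = 0 then \<epsilon> * r i else 0))"
    by (intro sum.cong) (auto simp: perturb_def)
  then show ?thesis
    using assms by (simp add: sum.distrib sum.inter_filter[symmetric] sum_distrib_left)
qed

theorem proposition4p2:
  fixes P :: "('i, 'j) flp"
    and D \<epsilon> :: real
    and ybar vbar :: "'i \<Rightarrow> real"
    and z :: "('i, 'j) dual"
  assumes "flp_data P"
    and "0 < D" and "D \<le> (\<Sum>j\<in>customers P. demand P j)"
    and "\<forall>i\<in>facilities P. 0 \<le> ybar i \<and> ybar i \<le> 1"
    and "\<forall>i\<in>facilities P. 0 \<le> vbar i"
    and "0 < \<epsilon>"
    and "dual_optimal P (perturb \<epsilon> ybar) (perturb \<epsilon> vbar) z"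
    and "dual_optimal P ybar vbar z"
  shows "opt_value P ybar vbar =
           opt_value P (perturb \<epsilon> ybar) (perturb \<epsilon> vbar)
             - \<epsilon> * (\<Sum>i\<in>{i \<in> facilities P. ybar i = 0}. red_cost_y P z i)
             - \<epsilon> * (\<Sum>i\<in>{i \<in> facilities P. vbar i = 0}. red_cost_v z i)
         \<and> (\<forall>y v.
             (\<forall>i\<in>facilities P. 0 \<le> y i \<and> y i \<le> 1) \<longrightarrow>
             (\<forall>i\<in>facilities P. 0 \<le> v i) \<longrightarrow>
             opt_value P y v \<ge> D \<longrightarrow>
             opt_value P ybar vbar
               + (\<Sum>i\<in>facilities P. red_cost_y P z i * (y i - ybar i))
               + (\<Sum>i\<in>facilities P. red_cost_v z i * (v i - vbar i)) \<ge> D)"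
proof (intro conjI allI impI)
  have feas: "dual_feasible P z"
    using assms(8) by (simp add: dual_optimal_def)
  have fin: "finite (facilities P)"
    using assms(1) by (simp add: flp_data_def)
  have val: "opt_value P ybar vbar = reduced_obj P ybar vbar z"
    using assms by (simp add: strong_duality dual_obj_eq_reduced_obj[OF feas, symmetric])
  have "opt_value P (perturb \<epsilon> ybar) (perturb \<epsilon> vbar)
      = reduced_obj P (perturb \<epsilon> ybar) (perturb \<epsilon> vbar) z"
    using assms
    by (simp add: strong_duality dual_obj_eq_reduced_obj[OF feas, symmetric] perturb_def)
  then show "opt_value P ybar vbar =
      opt_value P (perturb \<epsilon> ybar) (perturb \<epsilon> vbar)
        - \<epsilon> * (\<Sum>i\<in>{i \<in> facilities P. ybar i = 0}. red_cost_y P z i)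
        - \<epsilon> * (\<Sum>i\<in>{i \<in> facilities P. vbar i = 0}. red_cost_v z i)"
    using val fin by (simp add: reduced_obj_def sum_perturb)
  fix y v :: "'i \<Rightarrow> real"
  assume y: "\<forall>i\<in>facilities P. 0 \<le> y i \<and> y i \<le> 1" and v: "\<forall>i\<in>facilities P. 0 \<le> v i"
    and D: "D \<le> opt_value P y v"
  have "D \<le> reduced_obj P y v z"
    using D opt_value_le_dual_obj[OF assms(1) _ _ feas, of y v] y v
    by (simp add: dual_obj_eq_reduced_obj[OF feas])
  also have "\<dots> = opt_value P ybar vbar
      + (\<Sum>i\<in>facilities P. red_cost_y P z i * (y i - ybar i))
      + (\<Sum>i\<in>facilities P. red_cost_v z i * (v i - vbar i))"
    by (simp add: val reduced_obj_def right_diff_distrib sum_subtractf mult.commute)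
  finally show "D \<le> opt_value P ybar vbar
      + (\<Sum>i\<in>facilities P. red_cost_y P z i * (y i - ybar i))
      + (\<Sum>i\<in>facilities P. red_cost_v z i * (v i - vbar i))" .
qed

end
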